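(* For every real $\alpha\ge-1$, the ideal $$ \mathcal{I}_\alpha:=\left\{S\subseteq\mathbf{N}:\mathrm{d}_\alpha^\star(S)=0\right\},\quad\text{where}\quad \mathrm{d}_\alpha^\star(S)=\limsup_{n\to\infty}\frac{\sum_{i\in S\cap[1,n]}i^\alpha}{\sum_{i\in[1,n]}i^\alpha}, $$ is thinnable.
   Context: $\mathbf{N}$ denotes the set of positive integers, and sums over $i\in[1,n]$ range over integers $i$. An ideal $\mathcal{I}$ on $\mathbf{N}$ is a family of subsets of $\mathbf{N}$ closed under finite unions and under taking subsets of its elements; it is always assumed that $\mathcal{I}$ contains all finite subsets of $\mathbf{N}$ and that $\mathcal{I}$ is different from the whole power set of $\mathbf{N}$. For infinite sets $A,B\subseteq\mathbf{N}$ with canonical (increasing) enumerations $\{a_n:n\in\mathbf{N}\}$ and $\{b_n:n\in\mathbf{N}\}$, write $A\le B$ if $a_n\le b_n$ for all $n\in\mathbf{N}$, and define $A_B:=\{a_b:b\in B\}$. A set $A\subseteq\mathbf{N}$ admits non-zero asymptotic density if the limit $\lim_{n\to\infty}|A\cap[1,n]|/n$ exists and is positive. An ideal $\mathcal{I}$ is weakly thinnable if $A_B\notin\mathcal{I}$ whenever $A\subseteq\mathbf{N}$ admits non-zero asymptotic density and $B\notin\mathcal{I}$. An ideal $\mathcal{I}$ is thinnable if it is weakly thinnable and, in addition: (i) $B_A\notin\mathcal{I}$ whenever $A\subseteq\mathbf{N}$ admits non-zero asymptotic density and $B\notin\mathcal{I}$; and (ii) $X\notin\mathcal{I}$ whenever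 $X,Y\subseteq\mathbf{N}$ are infinite sets with $X\le Y$ and $Y\notin\mathcal{I}$. *)

theory Defs
  imports Complex_Main "HOL-Library.Infinite_Set" "HOL-Library.Liminf_Limsup"
    "HOL-Library.Extended_Real"
begin

text \<open>
  The set of positive integers is the subset \<open>{1..}\<close> of \<^typ>\<open>nat\<close>; every set considered is
  required to be contained in it.
\<close>

definition ideal_on_N :: "nat set set \<Rightarrow> bool" where
  "ideal_on_N I \<longleftrightarrow>
     I \<subseteq> Pow {1..} \<and>
     (\<forall>A\<in>I. \<forall>B\<in>I. A \<union> B \<in> I) \<and>
     (\<forall>A\<in>I. \<forall>B. B \<subseteq> A \<longrightarrow> B \<in> I) \<and>
     (\<forall>F. finite F \<and> F \<subseteq> {1..} \<longrightarrow> F \<in> I) \<and>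
     I \<noteq> Pow {1..}"

text \<open>
  The library function \<^const>\<open>enumerate\<close> counts from \<open>0\<close>, the canonical enumeration
  \<open>a\<^sub>1 < a\<^sub>2 < \<dots>\<close> of an infinite set counts from \<open>1\<close>. The value at \<open>n = 0\<close> is never used.
\<close>

definition canon_enum :: "nat set \<Rightarrow> nat \<Rightarrow> nat" where
  "canon_enum A n = enumerate A (n - 1)"

definition enum_le :: "nat set \<Rightarrow> nat set \<Rightarrow> bool" where
  "enum_le A B \<longleftrightarrow> (\<forall>n\<ge>1. canon_enum A n \<le> canon_enum B n)"

definition sub_enum :: "nat set \<Rightarrow> nat set \<Rightarrow> nat set" where
  "sub_enum A B = {canon_enum A b | b. b \<in> B}"

definition nonzero_density :: "nat set \<Rightarrow> bool" where
  "nonzero_density A \<longleftrightarrow>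
     (\<exists>d>0. (\<lambda>n. real (card (A \<inter> {1..n})) / real n) \<longlonglongrightarrow> d)"

text \<open>
  In the next two definitions the sets \<open>A\<close> and \<open>B\<close> are automatically infinite: \<open>A\<close> has positive
  density, and \<open>B\<close> lies outside an ideal that contains all finite sets.
\<close>

definition weakly_thinnable :: "nat set set \<Rightarrow> bool" where
  "weakly_thinnable I \<longleftrightarrow>
     ideal_on_N I \<and>
     (\<forall>A B. A \<subseteq> {1..} \<and> nonzero_density A \<and> B \<subseteq> {1..} \<and> B \<notin> I \<longrightarrow> sub_enum A B \<notin> I)"

definition thinnable :: "nat set set \<Rightarrow> bool" where
  "thinnable I \<longleftrightarrow>
     weakly_thinnable I \<and>
     (\<forall>A B. A \<subseteq> {1..} \<and> nonzero_density A \<and> B \<subseteq> {1..} \<and> B \<notin> I \<longrightarrow> sub_enum B A \<notin> I) \<and>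
     (\<forall>X Y. X \<subseteq> {1..} \<and> Y \<subseteq> {1..} \<and> infinite X \<and> infinite Y \<and> enum_le X Y \<and> Y \<notin> I
        \<longrightarrow> X \<notin> I)"

definition upper_density :: "real \<Rightarrow> nat set \<Rightarrow> ereal" where
  "upper_density \<alpha> S =
     limsup (\<lambda>n. ereal ((\<Sum>i\<in>S \<inter> {1..n}. real i powr \<alpha>) / (\<Sum>i\<in>{1..n}. real i powr \<alpha>)))"

definition ideal_alpha :: "real \<Rightarrow> nat set set" where
  "ideal_alpha \<alpha> = {S. S \<subseteq> {1..} \<and> upper_density \<alpha> S = 0}"

end

theory Submission
  imports Defs "HOL-Analysis.Harmonic_Numbers"
begin

text \<open>
  Give the integer \<open>i\<close> the weight \<open>i powr \<alpha>\<close>. As weights are nonnegative, the limsup in the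
  definition is \<open>0\<close> exactly if the weight ratios of the set tend to \<open>0\<close>.

  For \<open>-1 \<le> \<alpha> \<le> 0\<close> the weights do not increase, so moving elements down makes a set heavier, and
  dilating a set by a constant factor \<open>K\<close> changes weights and totals only by constant factors.
  This gives a single transfer principle, \<open>ideal_alpha_transfer\<close>: if the elements of \<open>Y\<close> can be
  sent to elements of \<open>X\<close> that are at most \<open>K\<close> times as large, with at most \<open>K\<close> elements of \<open>Y\<close>
  going to the same place, then \<open>X\<close> in the ideal forces \<open>Y\<close> in the ideal. Each of the three
  closure properties is an instance. Positive density of \<open>A\<close> enters only through a bound
  \<open>a\<^sub>n \<le> K n\<close> for all \<open>n \<ge> 1\<close>:

  \<^item> if \<open>X \<le> Y\<close>, send \<open>y\<^sub>j\<close> to \<open>x\<^sub>j\<close>;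
  \<^item> for \<open>A\<^sub>B\<close>, send \<open>b \<in> B\<close> to \<open>a\<^sub>b \<le> K b\<close>;
  \<^item> for \<open>B\<^sub>A\<close>, cut the indices of \<open>B\<close> into blocks of length \<open>K\<close> and send \<open>b\<^sub>j\<close> to the element of
    \<open>B\<close> with index \<open>a\<^sub>n\<close>, where \<open>n = j div K\<close>; this index is at most \<open>K n \<le> j\<close>. The first block,
    where \<open>n = 0\<close>, is finite and hence in the ideal, because the total weight diverges. This
    divergence is where \<open>\<alpha> \<ge> -1\<close> is needed.

  For \<open>\<alpha> > 0\<close> the weights increase and the transfer argument breaks down, but the ideal does not
  depend on \<open>\<alpha> \<ge> 0\<close> (\<open>ideal_alpha_eq_ideal_0\<close>): all but a small fraction of the integers in
  \<open>{1..n}\<close> have weight comparable to \<open>n powr \<alpha>\<close>, so a set is negligible for the weights exactly if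
  it is negligible for counting. This leads back to the exponent \<open>0\<close>.
\<close>

section \<open>Weight sums and the ideal\<close>

definition weight_sum :: "real \<Rightarrow> nat set \<Rightarrow> nat \<Rightarrow> real" where
  "weight_sum \<alpha> S n = (\<Sum>i\<in>S \<inter> {1..n}. real i powr \<alpha>)"

lemma weight_sum_nonneg: "weight_sum \<alpha> S n \<ge> 0"
  unfolding weight_sum_def by (intro sum_nonneg) auto

lemma weight_sum_mono: "S \<subseteq> T \<Longrightarrow> weight_sum \<alpha> S n \<le> weight_sum \<alpha> T n"
  unfolding weight_sum_def by (intro sum_mono2) auto

lemma weight_sum_union_le: "weight_sum \<alpha> (S \<union> T) n \<le> weight_sum \<alpha> S n + weight_sum \<alpha> T n"
proof -
  have "weight_sum \<alpha> (S \<union> T) n + (\<Sum>i\<in>(S \<inter> {1..n}) \<inter> (T \<inter> {1..n}). real i powr \<alpha>)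
      = weight_sum \<alpha> S n + weight_sum \<alpha> T n"
    unfolding weight_sum_def Int_Un_distrib2 by (intro sum.union_inter) auto
  moreover have "(\<Sum>i\<in>(S \<inter> {1..n}) \<inter> (T \<inter> {1..n}). real i powr \<alpha>) \<ge> 0"
    by (intro sum_nonneg) auto
  ultimately show ?thesis by linarith
qed

lemma weight_sum_finite_le:
  assumes "finite F"
  shows "weight_sum \<alpha> F n \<le> (\<Sum>i\<in>F. real i powr \<alpha>)"
  unfolding weight_sum_def using assms by (intro sum_mono2) auto

lemma total_weight_ge_1: "n \<ge> 1 \<Longrightarrow> weight_sum \<alpha> {1..} n \<ge> 1"
  unfolding weight_sum_def
  using member_le_sum[of 1 "{1..} \<inter> {1..n}" "\<lambda>i. real i powr \<alpha>"] by auto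

lemma mem_ideal_alpha_iff:
  "S \<in> ideal_alpha \<alpha> \<longleftrightarrow>
     S \<subseteq> {1..} \<and> (\<lambda>n. weight_sum \<alpha> S n / weight_sum \<alpha> {1..} n) \<longlonglongrightarrow> 0"
proof -
  define f where "f n = weight_sum \<alpha> S n / weight_sum \<alpha> {1..} n" for n
  have "{1..} \<inter> {1..n} = {1..n}" for n :: nat
    by auto
  then have f: "upper_density \<alpha> S = limsup (\<lambda>n. ereal (f n))"
    by (simp add: upper_density_def f_def weight_sum_def)
  have "0 \<le> ereal (f n)" for n
    by (simp add: f_def weight_sum_nonneg)
  then have "0 \<le> liminf (\<lambda>n. ereal (f n))"
    by (intro Liminf_bounded) simp
  moreover have "liminf (\<lambda>n. ereal (f n)) \<le> limsup (\<lambda>n. ereal (f n))"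
    by (intro Liminf_le_Limsup) simp
  ultimately have "limsup (\<lambda>n. ereal (f n)) = 0 \<longleftrightarrow> (\<lambda>n. ereal (f n)) \<longlonglongrightarrow> ereal 0"
    by (simp add: tendsto_iff_Liminf_eq_Limsup zero_ereal_def[symmetric] del: lim_ereal) auto
  then show ?thesis
    using f by (simp add: ideal_alpha_def f_def)
qed

lemma powr_ge_inverse: "\<alpha> \<ge> -1 \<Longrightarrow> i \<ge> 1 \<Longrightarrow> inverse (real i) \<le> real i powr \<alpha>"
  using powr_mono[of "-1" \<alpha> "real i"] by (simp add: powr_minus)

text \<open>
  The harmonic series is the extreme case: for \<open>\<alpha> \<ge> -1\<close> every weight is at least \<open>1 / i\<close>.
\<close>

lemma total_weight_at_top:
  assumes "\<alpha> \<ge> -1"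
  shows "filterlim (weight_sum \<alpha> {1..}) at_top sequentially"
proof (rule filterlim_at_top_mono)
  show "filterlim (\<lambda>n. ln (real n)) at_top sequentially"
    by (rule filterlim_compose[OF ln_at_top filterlim_real_sequentially])
  show "\<forall>\<^sub>F n in sequentially. ln (real n) \<le> weight_sum \<alpha> {1..} n"
    using eventually_gt_at_top[of 0]
  proof eventually_elim
    case (elim n)
    have "ln (real n) \<le> ln (real n + 1)"
      using elim by simp
    also have "\<dots> \<le> harm n"
      by (rule ln_le_harm)
    also have "\<dots> \<le> (\<Sum>i=1..n. real i powr \<alpha>)"
      unfolding harm_def using assms by (intro sum_mono powr_ge_inverse) auto
    also have "{1..n} = {1..} \<inter> {1..n}"
      by auto
    finally show ?case
      by (simp add: weight_sum_def)
  qed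
qed

lemma ideal_on_N_ideal_alpha:
  assumes "\<alpha> \<ge> -1"
  shows "ideal_on_N (ideal_alpha \<alpha>)"
  unfolding ideal_on_N_def
proof (intro conjI ballI allI impI)
  show "ideal_alpha \<alpha> \<subseteq> Pow {1..}"
    by (auto simp: ideal_alpha_def)
next
  fix A B assume "A \<in> ideal_alpha \<alpha>" "B \<in> ideal_alpha \<alpha>"
  then have AB: "A \<union> B \<subseteq> {1..}"
    and lim: "(\<lambda>n. weight_sum \<alpha> A n / weight_sum \<alpha> {1..} n
           + weight_sum \<alpha> B n / weight_sum \<alpha> {1..} n) \<longlonglongrightarrow> 0"
    by (auto simp: mem_ideal_alpha_iff intro!: tendsto_add_zero)
  have "(\<lambda>n. weight_sum \<alpha> (A \<union> B) n / weight_sum \<alpha> {1..} n) \<longlonglongrightarrow> 0"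
    by (rule tendsto_sandwich[OF _ _ tendsto_const lim])
      (auto intro!: always_eventually divide_right_mono weight_sum_union_le
        simp: weight_sum_nonneg simp flip: add_divide_distrib)
  with AB show "A \<union> B \<in> ideal_alpha \<alpha>"
    by (simp add: mem_ideal_alpha_iff)
next
  fix A B assume A: "A \<in> ideal_alpha \<alpha>" and "B \<subseteq> A"
  then have lim: "(\<lambda>n. weight_sum \<alpha> A n / weight_sum \<alpha> {1..} n) \<longlonglongrightarrow> 0"
    by (simp add: mem_ideal_alpha_iff)
  have "(\<lambda>n. weight_sum \<alpha> B n / weight_sum \<alpha> {1..} n) \<longlonglongrightarrow> 0"
    by (rule tendsto_sandwich[OF _ _ tendsto_const lim])
      (auto intro!: always_eventually divide_right_mono weight_sum_mono \<open>B \<subseteq> A\<close>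
        simp: weight_sum_nonneg)
  with A \<open>B \<subseteq> A\<close> show "B \<in> ideal_alpha \<alpha>"
    by (auto simp: mem_ideal_alpha_iff)
next
  fix F :: "nat set" assume F: "finite F \<and> F \<subseteq> {1..}"
  have lim: "(\<lambda>n. (\<Sum>i\<in>F. real i powr \<alpha>) / weight_sum \<alpha> {1..} n) \<longlonglongrightarrow> 0"
    by (rule tendsto_divide_0[OF tendsto_const])
      (rule filterlim_at_top_imp_at_infinity[OF total_weight_at_top[OF assms]])
  have "(\<lambda>n. weight_sum \<alpha> F n / weight_sum \<alpha> {1..} n) \<longlonglongrightarrow> 0"
    by (rule tendsto_sandwich[OF _ _ tendsto_const lim])
      (use F in \<open>auto intro!: always_eventually divide_right_mono weight_sum_finite_le
        simp: weight_sum_nonneg\<close>)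
  with F show "F \<in> ideal_alpha \<alpha>"
    by (simp add: mem_ideal_alpha_iff)
next
  have "\<forall>\<^sub>F n in sequentially. weight_sum \<alpha> {1..} n / weight_sum \<alpha> {1..} n = 1"
    using eventually_ge_at_top[of 1]
  proof eventually_elim
    case (elim n)
    then show ?case
      using total_weight_ge_1[of n \<alpha>] by simp
  qed
  then have "(\<lambda>n. weight_sum \<alpha> {1..} n / weight_sum \<alpha> {1..} n) \<longlonglongrightarrow> 1"
    by (rule tendsto_eventually)
  then have "{1..} \<notin> ideal_alpha \<alpha>"
    using LIMSEQ_unique[of _ "1::real" 0] by (auto simp: mem_ideal_alpha_iff)
  then show "ideal_alpha \<alpha> \<noteq> Pow {1..}"
    by auto
qed

section \<open>Transfer along bounded-to-one maps\<close>

text \<open>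
  Each of the \<open>K\<close> integers in the block \<open>K n < i \<le> K n + K\<close> exceeds \<open>n\<close>, so it weighs at most as
  much as \<open>n + 1\<close>.
\<close>

lemma total_weight_mult_le:
  assumes "\<alpha> \<le> 0" "K \<ge> 1"
  shows "weight_sum \<alpha> {1..} (K * n) \<le> real K * weight_sum \<alpha> {1..} n"
proof (induction n)
  case 0
  show ?case by (simp add: weight_sum_def)
next
  case (Suc n)
  have "n \<le> K * n"
    using assms(2) by simp
  have split: "{1..} \<inter> {1..K * Suc n} = ({1..} \<inter> {1..K * n}) \<union> {K * n + 1..K * n + K}"
    by auto
  have "weight_sum \<alpha> {1..} (K * Suc n)
      = weight_sum \<alpha> {1..} (K * n) + (\<Sum>i = K * n + 1..K * n + K. real i powr \<alpha>)"
    unfolding weight_sum_def split by (rule sum.union_disjoint) auto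
  also have "(\<Sum>i = K * n + 1..K * n + K. real i powr \<alpha>)
      \<le> (\<Sum>i = K * n + 1..K * n + K. real (Suc n) powr \<alpha>)"
  proof (intro sum_mono powr_mono2')
    fix i assume "i \<in> {K * n + 1..K * n + K}"
    then have "Suc n \<le> i"
      using \<open>n \<le> K * n\<close> unfolding atLeastAtMost_iff by linarith
    then show "real (Suc n) \<le> real i"
      by (rule of_nat_mono)
  qed (use assms(1) in auto)
  also have "\<dots> = real K * real (Suc n) powr \<alpha>"
    by simp
  also have "weight_sum \<alpha> {1..} (K * n) + real K * real (Suc n) powr \<alpha>
      \<le> real K * (weight_sum \<alpha> {1..} n + real (Suc n) powr \<alpha>)"
    using Suc.IH by (simp add: distrib_left)
  also have "weight_sum \<alpha> {1..} n + real (Suc n) powr \<alpha> = weight_sum \<alpha> {1..} (Suc n)"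
  proof -
    have "{1..} \<inter> {1..Suc n} = insert (Suc n) ({1..} \<inter> {1..n})"
      by auto
    then show ?thesis
      by (simp add: weight_sum_def)
  qed
  finally show ?case by simp
qed

text \<open>
  The label \<open>r j < K\<close> tells apart the indices with the same value \<open>x j\<close>; this expresses that \<open>x\<close>
  is at most \<open>K\<close>-to-one in a form in which a sum over \<open>J\<close> embeds into a sum over a product set.
  Passing from \<open>y j\<close> to \<open>x j \<le> K * y j\<close> costs a factor \<open>K powr (- \<alpha>)\<close>, the labels a factor \<open>K\<close>.
\<close>

lemma weight_sum_le_of_bounded_to_one:
  assumes "\<alpha> \<le> 0" "K \<ge> 1"
    and y: "inj_on y J" "y ` J \<subseteq> {1..}"
    and x: "x ` J \<subseteq> X" "X \<subseteq> {1..}" "\<And>j. j \<in> J \<Longrightarrow> x j \<le> K * y j"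
    and r: "inj_on (\<lambda>j. (x j, r j)) J" "\<And>j. j \<in> J \<Longrightarrow> r j < K"
  shows "weight_sum \<alpha> (y ` J) n \<le> real K powr (1 - \<alpha>) * weight_sum \<alpha> X (K * n)"
proof -
  define L where "L = {j \<in> J. y j \<le> n}"
  have yL: "y ` J \<inter> {1..n} = y ` L"
    using y(2) by (auto simp: L_def)
  have inj: "inj_on y L"
    using y(1) by (rule inj_on_subset) (auto simp: L_def)
  have injr: "inj_on (\<lambda>j. (x j, r j)) L"
    using r(1) by (rule inj_on_subset) (auto simp: L_def)
  have sub: "(\<lambda>j. (x j, r j)) ` L \<subseteq> (X \<inter> {1..K * n}) \<times> {..<K}"
  proof -
    have "x j \<in> X \<inter> {1..K * n} \<and> r j < K" if "j \<in> L" for j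
    proof -
      have "j \<in> J" "y j \<le> n"
        using that by (auto simp: L_def)
      then have "x j \<le> K * n"
        using x(3)[of j] mult_le_mono2[of "y j" n K] by linarith
      then show ?thesis
        using \<open>j \<in> J\<close> x(1,2) r(2) by auto
    qed
    then show ?thesis by auto
  qed
  have "weight_sum \<alpha> (y ` J) n = (\<Sum>j\<in>L. real (y j) powr \<alpha>)"
    unfolding weight_sum_def yL by (simp add: sum.reindex[OF inj])
  also have "\<dots> \<le> (\<Sum>j\<in>L. real K powr (- \<alpha>) * real (x j) powr \<alpha>)"
  proof (rule sum_mono)
    fix j assume "j \<in> L"
    then have j: "j \<in> J"
      by (simp add: L_def)
    have "real (y j) powr \<alpha> = real K powr (- \<alpha>) * real (K * y j) powr \<alpha>"
      using \<open>K \<ge> 1\<close> by (simp add: powr_mult powr_minus)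
    also have "x j \<ge> 1"
      using x(1,2) j by auto
    then have "real (K * y j) powr \<alpha> \<le> real (x j) powr \<alpha>"
      using x(3)[OF j] \<open>\<alpha> \<le> 0\<close> by (intro powr_mono2') (auto simp del: of_nat_mult)
    finally show "real (y j) powr \<alpha> \<le> real K powr (- \<alpha>) * real (x j) powr \<alpha>"
      by (simp add: mult_left_mono)
  qed
  also have "\<dots> = real K powr (- \<alpha>) * (\<Sum>p\<in>(\<lambda>j. (x j, r j)) ` L. real (fst p) powr \<alpha>)"
    by (simp add: sum.reindex[OF injr] sum_distrib_left)
  also have "\<dots> \<le> real K powr (- \<alpha>) * (\<Sum>p\<in>(X \<inter> {1..K * n}) \<times> {..<K}. real (fst p) powr \<alpha>)"
    using sub by (intro mult_left_mono sum_mono2) auto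
  also have "(\<Sum>p\<in>(X \<inter> {1..K * n}) \<times> {..<K}. real (fst p) powr \<alpha>)
      = real K * weight_sum \<alpha> X (K * n)"
    using sum.cartesian_product[of "\<lambda>i _. real i powr \<alpha>" "{..<K}" "X \<inter> {1..K * n}"]
    by (simp add: weight_sum_def sum_distrib_left case_prod_unfold)
  also have "real K powr (- \<alpha>) * (real K * weight_sum \<alpha> X (K * n))
      = real K powr (1 - \<alpha>) * weight_sum \<alpha> X (K * n)"
    using \<open>K \<ge> 1\<close> by (simp add: powr_diff powr_minus field_simps)
  finally show ?thesis .
qed

text \<open>
  The previous bound compares \<open>Y\<close> up to \<open>n\<close> with \<open>X\<close> up to \<open>K n\<close>. The total weights at these two
  places differ by a factor of at most \<open>K\<close>, so the weight ratio of \<open>Y\<close> at \<open>n\<close> is at most a constant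
  times that of \<open>X\<close> at \<open>K n\<close>.
\<close>

lemma ideal_alpha_transfer:
  assumes "\<alpha> \<le> 0" "K \<ge> 1"
    and y: "inj_on y J" "y ` J \<subseteq> {1..}"
    and x: "x ` J \<subseteq> X" "\<And>j. j \<in> J \<Longrightarrow> x j \<le> K * y j"
    and r: "inj_on (\<lambda>j. (x j, r j)) J" "\<And>j. j \<in> J \<Longrightarrow> r j < K"
    and X: "X \<in> ideal_alpha \<alpha>"
  shows "y ` J \<in> ideal_alpha \<alpha>"
proof -
  let ?W = "weight_sum \<alpha> {1..}"
  define C where "C = real K powr (1 - \<alpha>) * real K"
  have X1: "X \<subseteq> {1..}" and limX: "(\<lambda>n. weight_sum \<alpha> X n / ?W n) \<longlonglongrightarrow> 0"
    using X by (auto simp: mem_ideal_alpha_iff)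
  have "filterlim (\<lambda>n. K * n) at_top sequentially"
    using \<open>K \<ge> 1\<close> by (intro filterlim_subseq strict_monoI) auto
  then have "(\<lambda>n. weight_sum \<alpha> X (K * n) / ?W (K * n)) \<longlonglongrightarrow> 0"
    by (rule filterlim_compose[OF limX])
  then have lim: "(\<lambda>n. C * (weight_sum \<alpha> X (K * n) / ?W (K * n))) \<longlonglongrightarrow> 0"
    by (rule tendsto_mult_right_zero)
  have "(\<lambda>n. weight_sum \<alpha> (y ` J) n / ?W n) \<longlonglongrightarrow> 0"
  proof (rule tendsto_sandwich[OF _ _ tendsto_const lim])
    show "\<forall>\<^sub>F n in sequentially. 0 \<le> weight_sum \<alpha> (y ` J) n / ?W n"
      by (simp add: weight_sum_nonneg)
    show "\<forall>\<^sub>F n in sequentially.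
        weight_sum \<alpha> (y ` J) n / ?W n \<le> C * (weight_sum \<alpha> X (K * n) / ?W (K * n))"
      using eventually_ge_at_top[of 1]
    proof eventually_elim
      case (elim n)
      have pos: "?W n > 0" "?W (K * n) > 0"
        using total_weight_ge_1[of n \<alpha>] total_weight_ge_1[of "K * n" \<alpha>] elim \<open>K \<ge> 1\<close> by auto
      have "weight_sum \<alpha> (y ` J) n / ?W n
          \<le> real K powr (1 - \<alpha>) * weight_sum \<alpha> X (K * n) / ?W n"
        using weight_sum_le_of_bounded_to_one[OF assms(1,2) y x(1) X1 x(2) r] pos
        by (intro divide_right_mono) auto
      also have "\<dots> \<le> real K powr (1 - \<alpha>) * weight_sum \<alpha> X (K * n) / (?W (K * n) / real K)"
        using total_weight_mult_le[OF assms(1,2), of n] pos \<open>K \<ge> 1\<close>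
        by (intro divide_left_mono) (auto simp: weight_sum_nonneg field_simps)
      finally show ?case
        by (simp add: C_def mult_ac)
    qed
  qed
  with y(2) show ?thesis
    by (simp add: mem_ideal_alpha_iff)
qed

section \<open>Canonical enumerations and density\<close>

lemma canon_enum_mem: "infinite A \<Longrightarrow> canon_enum A n \<in> A"
  by (simp add: canon_enum_def enumerate_in_set)

lemma canon_enum_strict_mono_on: "infinite A \<Longrightarrow> strict_mono_on {1..} (canon_enum A)"
  by (auto simp: strict_mono_on_def canon_enum_def intro!: enumerate_mono)

lemma canon_enum_inj_on: "infinite A \<Longrightarrow> inj_on (canon_enum A) {1..}"
  by (intro strict_mono_on_imp_inj_on canon_enum_strict_mono_on)

lemma canon_enum_mono: "infinite A \<Longrightarrow> 1 \<le> m \<Longrightarrow> m \<le> n \<Longrightarrow> canon_enum A m \<le> canon_enum A n"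
  by (simp add: canon_enum_def)

lemma canon_enum_image:
  assumes "infinite A"
  shows "canon_enum A ` {1..} = A"
proof -
  have "(\<lambda>n. n - 1) ` {1..} = (UNIV :: nat set)"
    by (auto intro!: image_eqI[of _ _ "Suc _"])
  moreover have "canon_enum A ` {1..} = enumerate A ` (\<lambda>n. n - 1) ` {1..}"
    by (simp add: image_image canon_enum_def)
  ultimately show ?thesis
    using range_enumerate[OF assms] by simp
qed

lemma canon_enum_le_of_card:
  assumes "infinite A" "A \<subseteq> {1..}" "n \<ge> 1" "card (A \<inter> {1..m}) \<ge> n"
  shows "canon_enum A n \<le> m"
proof (rule ccontr)
  assume "\<not> canon_enum A n \<le> m"
  have "A \<inter> {1..m} \<subseteq> canon_enum A ` {1..<n}"
  proof
    fix a assume a: "a \<in> A \<inter> {1..m}"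
    then obtain k where k: "k \<ge> 1" "a = canon_enum A k"
      using canon_enum_image[OF assms(1)] by fastforce
    have "k < n"
    proof (rule ccontr)
      assume "\<not> k < n"
      then have "canon_enum A n \<le> a"
        using canon_enum_mono[OF assms(1,3), of k] k(2) by simp
      then show False
        using a \<open>\<not> canon_enum A n \<le> m\<close> by auto
    qed
    then show "a \<in> canon_enum A ` {1..<n}"
      using k by auto
  qed
  then have "card (A \<inter> {1..m}) \<le> card {1..<n}"
    by (meson card_image_le card_mono finite_atLeastLessThan finite_imageI le_trans)
  then show False
    using assms(3,4) by simp
qed

lemma nonzero_density_infinite:
  assumes "nonzero_density A"
  shows "infinite A"
proof
  assume "finite A"
  obtain d where d: "d > 0" "(\<lambda>n. real (card (A \<inter> {1..n})) / real n) \<longlonglongrightarrow> d"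
    using assms by (auto simp: nonzero_density_def)
  have "(\<lambda>n. real (card A) / real n) \<longlonglongrightarrow> 0"
    by (rule lim_const_over_n)
  then have "(\<lambda>n. real (card (A \<inter> {1..n})) / real n) \<longlonglongrightarrow> 0"
    by (rule tendsto_sandwich[OF _ _ tendsto_const, rotated -1])
      (use \<open>finite A\<close> in \<open>auto intro!: always_eventually divide_right_mono card_mono\<close>)
  with d show False
    using LIMSEQ_unique by blast
qed

text \<open>
  If \<open>A\<close> has density \<open>d\<close>, then from some \<open>m\<close> on it fills at least the fraction \<open>d / 2\<close> of every
  initial segment. With \<open>K \<ge> 2 / d\<close> the segment up to \<open>K n\<close> therefore contains \<open>n\<close> elements, and
  \<open>K \<ge> m\<close> makes this true for every \<open>n \<ge> 1\<close>, not only for large ones.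
\<close>

lemma nonzero_density_canon_enum_le:
  assumes "A \<subseteq> {1..}" "nonzero_density A"
  obtains K where "K \<ge> 1" "\<And>n. n \<ge> 1 \<Longrightarrow> canon_enum A n \<le> K * n"
proof -
  obtain d where d: "d > 0" "(\<lambda>n. real (card (A \<inter> {1..n})) / real n) \<longlonglongrightarrow> d"
    using assms by (auto simp: nonzero_density_def)
  have "\<forall>\<^sub>F n in sequentially. real (card (A \<inter> {1..n})) / real n > d / 2"
    using d by (intro order_tendstoD(1)[OF d(2)]) simp
  then obtain m where m: "\<And>n. n \<ge> m \<Longrightarrow> real (card (A \<inter> {1..n})) / real n > d / 2"
    by (auto simp: eventually_sequentially)
  define K where "K = max (max m 1) (nat \<lceil>2 / d\<rceil>)"
  have K: "K \<ge> 1" "K \<ge> m" "real K \<ge> 2 / d"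
    by (auto simp: K_def) linarith
  show ?thesis
  proof
    show "K \<ge> 1" by fact
    fix n :: nat assume n: "n \<ge> 1"
    have "real n \<le> d / 2 * real (K * n)"
      using K(3) d(1) n by (simp add: field_simps)
    also have "K * n \<ge> m"
      using K(2) n by (metis le_trans mult.right_neutral mult_le_mono2)
    then have "d / 2 * real (K * n) \<le> real (card (A \<inter> {1..K * n}))"
      using m[of "K * n"] n K(1) by (simp add: field_simps)
    finally show "canon_enum A n \<le> K * n"
      using nonzero_density_infinite[OF assms(2)] assms(1) n
      by (intro canon_enum_le_of_card) auto
  qed
qed

section \<open>The closure properties for nonpositive exponents\<close>

lemma ideal_alpha_enum_le:
  assumes "\<alpha> \<le> 0" "Y \<subseteq> {1..}" "infinite X" "infinite Y" "enum_le X Y"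
    and "X \<in> ideal_alpha \<alpha>"
  shows "Y \<in> ideal_alpha \<alpha>"
proof -
  have "canon_enum Y ` {1..} \<in> ideal_alpha \<alpha>"
  proof (rule ideal_alpha_transfer[where K = 1 and x = "canon_enum X" and r = "\<lambda>_. 0" and X = X])
    show "canon_enum Y ` {1..} \<subseteq> {1..}" "canon_enum X ` {1..} \<subseteq> X"
      using canon_enum_image[OF assms(3)] canon_enum_image[OF assms(4)] assms(2) by auto
    show "inj_on (canon_enum Y) {1..}"
      by (rule canon_enum_inj_on[OF assms(4)])
    show "inj_on (\<lambda>j. (canon_enum X j, 0::nat)) {1..}"
      using canon_enum_inj_on[OF assms(3)] unfolding inj_on_def prod.inject by blast
    show "canon_enum X j \<le> 1 * canon_enum Y j" if "j \<in> {1..}" for j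
      using assms(5) that by (simp add: enum_le_def)
  qed (use assms in simp_all)
  then show ?thesis
    unfolding canon_enum_image[OF assms(4)] .
qed

lemma ideal_alpha_sub_enum_outer:
  assumes "\<alpha> \<le> 0" "A \<subseteq> {1..}" "nonzero_density A" "B \<subseteq> {1..}"
    and "sub_enum A B \<in> ideal_alpha \<alpha>"
  shows "B \<in> ideal_alpha \<alpha>"
proof -
  obtain K where K: "K \<ge> 1" "\<And>n. n \<ge> 1 \<Longrightarrow> canon_enum A n \<le> K * n"
    using nonzero_density_canon_enum_le[OF assms(2,3)] by blast
  have inj: "inj_on (canon_enum A) B"
    using canon_enum_inj_on[OF nonzero_density_infinite[OF assms(3)]] assms(4)
    by (rule inj_on_subset)
  have "id ` B \<in> ideal_alpha \<alpha>"
  proof (rule ideal_alpha_transfer[where K = K and x = "canon_enum A" and r = "\<lambda>_. 0"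
        and X = "sub_enum A B"])
    show "inj_on (\<lambda>j. (canon_enum A j, 0::nat)) B"
      using inj unfolding inj_on_def prod.inject by blast
    show "canon_enum A ` B \<subseteq> sub_enum A B"
      by (auto simp: sub_enum_def)
    show "canon_enum A j \<le> K * id j" if "j \<in> B" for j
      using K(2)[of j] assms(4) that by auto
  qed (use assms K(1) in simp_all)
  then show ?thesis by simp
qed

text \<open>
  The block map \<open>j \<mapsto> j div K\<close> is \<open>K\<close>-to-one with label \<open>j mod K\<close>. It is applied only to indices
  \<open>j \<ge> K\<close>, since the enumeration of \<open>A\<close> starts at index \<open>1\<close>.
\<close>

lemma ideal_alpha_sub_enum_inner:
  assumes "\<alpha> \<ge> -1" "\<alpha> \<le> 0" "A \<subseteq> {1..}" "nonzero_density A" "B \<subseteq> {1..}" "infinite B"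
    and "sub_enum B A \<in> ideal_alpha \<alpha>"
  shows "B \<in> ideal_alpha \<alpha>"
proof -
  obtain K where K: "K \<ge> 1" "\<And>n. n \<ge> 1 \<Longrightarrow> canon_enum A n \<le> K * n"
    using nonzero_density_canon_enum_le[OF assms(3,4)] by blast
  have infA: "infinite A"
    by (rule nonzero_density_infinite[OF assms(4)])
  define x where "x j = canon_enum B (canon_enum A (j div K))" for j
  have div1: "j div K \<ge> 1" if "j \<ge> K" for j
    using that K(1) by (simp add: div_greater_zero_iff Suc_le_eq)
  have A1: "canon_enum A n \<ge> 1" for n
    using canon_enum_mem[OF infA] assms(3) by auto
  have "canon_enum B ` {K..} \<in> ideal_alpha \<alpha>"
  proof (rule ideal_alpha_transfer[where K = K and x = x and r = "\<lambda>j. j mod K"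
        and X = "sub_enum B A"])
    show "inj_on (canon_enum B) {K..}"
      using canon_enum_inj_on[OF assms(6)] by (rule inj_on_subset) (use K in auto)
    show "canon_enum B ` {K..} \<subseteq> {1..}"
      using canon_enum_mem[OF assms(6)] assms(5) by blast
    show "x ` {K..} \<subseteq> sub_enum B A"
      by (auto simp: x_def sub_enum_def canon_enum_mem[OF infA])
    show "x j \<le> K * canon_enum B j" if "j \<in> {K..}" for j
    proof -
      have "canon_enum A (j div K) \<le> K * (j div K)"
        using K(2) div1 that by simp
      also have "\<dots> \<le> j"
        by simp
      finally have "x j \<le> canon_enum B j"
        unfolding x_def by (intro canon_enum_mono assms(6) A1)
      also have "\<dots> \<le> K * canon_enum B j"
        using K(1) by simp
      finally show ?thesis .
    qed
    show "inj_on (\<lambda>j. (x j, j mod K)) {K..}"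
    proof (rule inj_onI)
      fix i j assume ij: "i \<in> {K..}" "j \<in> {K..}" "(x i, i mod K) = (x j, j mod K)"
      then have "canon_enum A (i div K) = canon_enum A (j div K)"
        using canon_enum_inj_on[OF assms(6)] A1 by (auto simp: x_def dest: inj_onD)
      then have "i div K = j div K"
        using canon_enum_inj_on[OF infA] div1 ij(1,2) by (auto dest!: inj_onD)
      then show "i = j"
        using ij(3) by (metis div_mult_mod_eq prod.inject)
    qed
  qed (use assms K in auto)
  moreover have "canon_enum B ` {1..<K} \<in> ideal_alpha \<alpha>"
  proof -
    have "canon_enum B ` {1..<K} \<subseteq> {1..}"
      using canon_enum_mem[OF assms(6)] assms(5) by blast
    then show ?thesis
      using ideal_on_N_ideal_alpha[OF assms(1)] by (simp add: ideal_on_N_def)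
  qed
  ultimately have "canon_enum B ` {1..<K} \<union> canon_enum B ` {K..} \<in> ideal_alpha \<alpha>"
    using ideal_on_N_ideal_alpha[OF assms(1)] by (simp add: ideal_on_N_def)
  moreover have "canon_enum B ` {1..<K} \<union> canon_enum B ` {K..} = B"
  proof -
    have "{1..<K} \<union> {K..} = {1..}"
      using K(1) by auto
    then show ?thesis
      using canon_enum_image[OF assms(6)] by (simp flip: image_Un)
  qed
  ultimately show ?thesis
    by simp
qed

lemma thinnable_ideal_alpha_nonpos:
  assumes "\<alpha> \<ge> -1" "\<alpha> \<le> 0"
  shows "thinnable (ideal_alpha \<alpha>)"
proof -
  have inf: "infinite B" if "B \<subseteq> {1..}" "B \<notin> ideal_alpha \<alpha>" for B
    using ideal_on_N_ideal_alpha[OF assms(1)] that by (auto simp: ideal_on_N_def)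
  show ?thesis
    unfolding thinnable_def weakly_thinnable_def
  proof (intro conjI allI impI ideal_on_N_ideal_alpha assms(1); elim conjE)
    fix A B :: "nat set"
    assume AB: "A \<subseteq> {1..}" "nonzero_density A" "B \<subseteq> {1..}" "B \<notin> ideal_alpha \<alpha>"
    show "sub_enum A B \<notin> ideal_alpha \<alpha>"
      using ideal_alpha_sub_enum_outer[OF assms(2) AB(1-3)] AB(4) by (rule contrapos_nn[rotated])
    show "sub_enum B A \<notin> ideal_alpha \<alpha>"
      using ideal_alpha_sub_enum_inner[OF assms AB(1-3) inf[OF AB(3,4)]] AB(4)
      by (rule contrapos_nn[rotated])
  next
    fix X Y :: "nat set"
    assume XY: "Y \<subseteq> {1..}" "infinite X" "infinite Y" "enum_le X Y" "Y \<notin> ideal_alpha \<alpha>"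
    show "X \<notin> ideal_alpha \<alpha>"
      using ideal_alpha_enum_le[OF assms(2) XY(1-4)] XY(5) by (rule contrapos_nn[rotated])
  qed
qed

section \<open>Nonnegative exponents give one ideal\<close>

lemma total_weight_le_powr:
  assumes "\<alpha> \<ge> 0"
  shows "weight_sum \<alpha> {1..} n \<le> real n * real n powr \<alpha>"
proof -
  have "weight_sum \<alpha> {1..} n \<le> (\<Sum>i\<in>{1..} \<inter> {1..n}. real n powr \<alpha>)"
    unfolding weight_sum_def using assms by (intro sum_mono powr_mono2) auto
  moreover have "{1..} \<inter> {1..n} = {1..n}"
    by auto
  ultimately show ?thesis by simp
qed

text \<open>
  The upper half of \<open>{1..n}\<close> alone carries this much weight.
\<close>

lemma total_weight_ge_powr:
  assumes "\<alpha> \<ge> 0"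
  shows "weight_sum \<alpha> {1..} n \<ge> (real n / 2) * (real n / 2) powr \<alpha>"
proof -
  have "real n / 2 \<le> real (card {n div 2 + 1..n})"
    by (simp add: field_simps)
  then have "(real n / 2) * (real n / 2) powr \<alpha> \<le> (\<Sum>i = n div 2 + 1..n. (real n / 2) powr \<alpha>)"
    unfolding sum_constant by (rule mult_right_mono) simp
  also have "\<dots> \<le> (\<Sum>i = n div 2 + 1..n. real i powr \<alpha>)"
  proof (intro sum_mono powr_mono2)
    fix i assume "i \<in> {n div 2 + 1..n}"
    then show "real n / 2 \<le> real i"
      by (simp add: field_simps) linarith
  qed (use assms in auto)
  also have "\<dots> \<le> weight_sum \<alpha> {1..} n"
    unfolding weight_sum_def by (intro sum_mono2) auto
  finally show ?thesis .
qed

lemma weight_sum_0: "weight_sum 0 S n = real (card (S \<inter> {1..n}))"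
proof -
  have "weight_sum 0 S n = (\<Sum>i\<in>S \<inter> {1..n}. 1)"
    unfolding weight_sum_def by (intro sum.cong) auto
  then show ?thesis by simp
qed

lemma weight_ratio_le_card_ratio:
  assumes "\<alpha> \<ge> 0" "n \<ge> 1"
  shows "weight_sum \<alpha> S n / weight_sum \<alpha> {1..} n
    \<le> 2 * 2 powr \<alpha> * (real (card (S \<inter> {1..n})) / real n)"
proof -
  have "weight_sum \<alpha> S n \<le> (\<Sum>i\<in>S \<inter> {1..n}. real n powr \<alpha>)"
    unfolding weight_sum_def using assms by (intro sum_mono powr_mono2) auto
  then have "weight_sum \<alpha> S n / weight_sum \<alpha> {1..} n
      \<le> (real (card (S \<inter> {1..n})) * real n powr \<alpha>) / ((real n / 2) * (real n / 2) powr \<alpha>)"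
    using total_weight_ge_powr[OF assms(1), of n] assms(2)
    by (intro frac_le) auto
  also have "\<dots> = 2 * 2 powr \<alpha> * (real (card (S \<inter> {1..n})) / real n)"
    using assms(2) by (simp add: powr_divide)
  finally show ?thesis .
qed

text \<open>
  Elements of \<open>S\<close> up to \<open>\<epsilon> n\<close> contribute at most \<open>\<epsilon>\<close> to the ratio on the left; each of the others
  weighs at least \<open>(\<epsilon> n) powr \<alpha>\<close>, so their number is controlled by the weight of \<open>S\<close>.
\<close>

lemma card_ratio_le_weight_ratio:
  assumes "\<alpha> \<ge> 0" "n \<ge> 1" "\<epsilon> > 0"
  shows "real (card (S \<inter> {1..n})) / real n
    \<le> \<epsilon> + \<epsilon> powr (- \<alpha>) * (weight_sum \<alpha> S n / weight_sum \<alpha> {1..} n)"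
proof -
  define m where "m = nat \<lfloor>\<epsilon> * real n\<rfloor>"
  have "\<epsilon> * real n > 0"
    using assms by simp
  have m: "real m \<le> \<epsilon> * real n"
    using \<open>\<epsilon> * real n > 0\<close> by (simp add: m_def)
  have "S \<inter> {1..n} \<subseteq> {1..m} \<union> (S \<inter> {m<..n})"
    by auto
  then have "card (S \<inter> {1..n}) \<le> card ({1..m} \<union> (S \<inter> {m<..n}))"
    by (intro card_mono) auto
  also have "\<dots> \<le> m + card (S \<inter> {m<..n})"
    using card_Un_le[of "{1..m}" "S \<inter> {m<..n}"] by simp
  finally have "real (card (S \<inter> {1..n})) \<le> \<epsilon> * real n + real (card (S \<inter> {m<..n}))"
    using m by linarith
  moreover have "real (card (S \<inter> {m<..n})) \<le> (\<epsilon> * real n) powr (- \<alpha>) * weight_sum \<alpha> S n"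
  proof -
    have "real (card (S \<inter> {m<..n})) * (\<epsilon> * real n) powr \<alpha>
        = (\<Sum>i\<in>S \<inter> {m<..n}. (\<epsilon> * real n) powr \<alpha>)"
      by simp
    also have "\<dots> \<le> (\<Sum>i\<in>S \<inter> {m<..n}. real i powr \<alpha>)"
    proof (intro sum_mono powr_mono2)
      fix i assume "i \<in> S \<inter> {m<..n}"
      then show "\<epsilon> * real n \<le> real i"
        unfolding m_def by auto linarith
    qed (use assms in auto)
    also have "\<dots> \<le> weight_sum \<alpha> S n"
      unfolding weight_sum_def by (intro sum_mono2) auto
    finally have "real (card (S \<inter> {m<..n})) * (\<epsilon> * real n) powr \<alpha> \<le> weight_sum \<alpha> S n" .
    moreover have "(\<epsilon> * real n) powr \<alpha> > 0"
      using \<open>\<epsilon> * real n > 0\<close> by (metis less_irrefl powr_gt_zero)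
    ultimately show ?thesis
      by (simp add: powr_minus divide_simps mult_ac)
  qed
  ultimately have "real (card (S \<inter> {1..n})) / real n
      \<le> (\<epsilon> * real n + (\<epsilon> * real n) powr (- \<alpha>) * weight_sum \<alpha> S n) / real n"
    by (intro divide_right_mono) auto
  also have "\<dots> = \<epsilon> + \<epsilon> powr (- \<alpha>) * (weight_sum \<alpha> S n / (real n * real n powr \<alpha>))"
    using assms by (simp add: powr_mult powr_minus field_simps)
  also have "\<dots> \<le> \<epsilon> + \<epsilon> powr (- \<alpha>) * (weight_sum \<alpha> S n / weight_sum \<alpha> {1..} n)"
    using total_weight_le_powr[OF assms(1), of n] total_weight_ge_1[OF assms(2), of \<alpha>] assms(2)
    by (intro add_left_mono mult_left_mono divide_left_mono) (auto simp: weight_sum_nonneg)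
  finally show ?thesis .
qed

lemma ideal_alpha_eq_ideal_0:
  assumes "\<alpha> \<ge> 0"
  shows "ideal_alpha \<alpha> = ideal_alpha 0"
proof -
  have "{1..} \<inter> {1..n} = {1..n}" for n :: nat
    by auto
  then have ratio0: "weight_sum 0 S n / weight_sum 0 {1..} n = real (card (S \<inter> {1..n})) / real n"
    for S n
    by (simp add: weight_sum_0)
  have "(\<lambda>n. weight_sum \<alpha> S n / weight_sum \<alpha> {1..} n) \<longlonglongrightarrow> 0
    \<longleftrightarrow> (\<lambda>n. real (card (S \<inter> {1..n})) / real n) \<longlonglongrightarrow> 0" (is "?f \<longlonglongrightarrow> 0 \<longleftrightarrow> ?g \<longlonglongrightarrow> 0") for S
  proof
    assume f: "?f \<longlonglongrightarrow> 0"
    show "?g \<longlonglongrightarrow> 0"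
    proof (rule tendstoI)
      fix \<epsilon> :: real assume "\<epsilon> > 0"
      have "(\<lambda>n. \<epsilon> / 2 + (\<epsilon> / 2) powr (- \<alpha>) * ?f n) \<longlonglongrightarrow> \<epsilon> / 2 + (\<epsilon> / 2) powr (- \<alpha>) * 0"
        by (intro tendsto_intros f)
      then have "\<forall>\<^sub>F n in sequentially. \<epsilon> / 2 + (\<epsilon> / 2) powr (- \<alpha>) * ?f n < \<epsilon>"
        by (rule order_tendstoD(2)) (use \<open>\<epsilon> > 0\<close> in simp)
      then show "\<forall>\<^sub>F n in sequentially. dist (?g n) 0 < \<epsilon>"
        using eventually_ge_at_top[of 1]
      proof eventually_elim
        case (elim n)
        then show ?case
          using card_ratio_le_weight_ratio[OF assms, of n "\<epsilon> / 2" S] \<open>\<epsilon> > 0\<close> by simp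
      qed
    qed
  next
    assume g: "?g \<longlonglongrightarrow> 0"
    have lim: "(\<lambda>n. 2 * 2 powr \<alpha> * ?g n) \<longlonglongrightarrow> 0"
      using g by (rule tendsto_mult_right_zero)
    show "?f \<longlonglongrightarrow> 0"
    proof (rule tendsto_sandwich[OF _ _ tendsto_const lim])
      show "\<forall>\<^sub>F n in sequentially. 0 \<le> ?f n"
        by (simp add: weight_sum_nonneg)
      show "\<forall>\<^sub>F n in sequentially. ?f n \<le> 2 * 2 powr \<alpha> * ?g n"
        using eventually_ge_at_top[of 1]
        by eventually_elim (rule weight_ratio_le_card_ratio[OF assms])
    qed
  qed
  then show ?thesis
    by (intro set_eqI) (simp only: mem_ideal_alpha_iff ratio0)
qed

theorem proposition2p4:
  fixes \<alpha> :: real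
  assumes "\<alpha> \<ge> -1"
  shows "thinnable (ideal_alpha \<alpha>)"
proof (cases "\<alpha> \<le> 0")
  case True
  with assms show ?thesis
    by (rule thinnable_ideal_alpha_nonpos)
next
  case False
  then show ?thesis
    using thinnable_ideal_alpha_nonpos[of 0] ideal_alpha_eq_ideal_0[of \<alpha>] by simp
qed

end
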